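(* There exists an algorithm which, given positive integers $E,w_1,\dots,w_n$ with $E<\sum_{i=1}^n w_i$ and a player $i\in\{1,\dots,n\}$, computes the component $\phi_i$ of the Shapley value of the bankruptcy game $\mathrm{BG}[E;w_1,\dots,w_n]$ in $O(n^2E)$ time, where time is counted as the number of elementary arithmetic operations.
   Context: Let $N=\{1,\dots,n\}$. The bankruptcy game $\mathrm{BG}[E;w_1,\dots,w_n]$ (with $0<E<\sum_{i\in N}w_i$) is the cooperative game $(N,v)$ with $v(S)=\max\{0,\,E-\sum_{i\in N\setminus S}w_i\}$ for all $S\subseteq N$. A permutation of $N$ is a bijection $\pi:\{1,\dots,n\}\to N$; $\Pi_N$ is the set of all of them; $\mathrm{Prc}(\pi,i)$ is the set of players preceding $i$ in $\pi$. The Shapley value of $(N,v)$ is $\phi=(\phi_1,\dots,\phi_n)$ with $\phi_i=\frac{1}{n!}\sum_{\pi\in\Pi_N}\bigl(v(\mathrm{Prc}(\pi,i)\cup\{i\})-v(\mathrm{Prc}(\pi,i))\bigr)$. *)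

theory Defs
  imports Complex_Main "HOL-Library.FuncSet" "HOL-Library.Monad_Syntax"
begin

section \<open>Bankruptcy games and the Shapley value\<close>

definition bankruptcy_game :: "'p set \<Rightarrow> real \<Rightarrow> ('p \<Rightarrow> real) \<Rightarrow> 'p set \<Rightarrow> real" where
  "bankruptcy_game N E w S = max 0 (E - (\<Sum>j\<in>N - S. w j))"

text \<open>Functions are cut down to \<open>{1..card N}\<close> by \<open>extensional\<close>, so that every bijection
  \<open>{1..card N} \<rightarrow> N\<close> is counted exactly once.\<close>

definition player_perms :: "'p set \<Rightarrow> (nat \<Rightarrow> 'p) set" where
  "player_perms N = {\<pi> \<in> extensional {1..card N}. bij_betw \<pi> {1..card N} N}"

definition Prc :: "'p set \<Rightarrow> (nat \<Rightarrow> 'p) \<Rightarrow> 'p \<Rightarrow> 'p set" where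
  "Prc N \<pi> i = {\<pi> k |k. \<exists>l\<in>{1..card N}. \<pi> l = i \<and> k \<in> {1..<l}}"

definition shapley :: "'p set \<Rightarrow> ('p set \<Rightarrow> real) \<Rightarrow> 'p \<Rightarrow> real" where
  "shapley N v i =
     1 / fact (card N) * (\<Sum>\<pi>\<in>player_perms N. v (Prc N \<pi> i \<union> {i}) - v (Prc N \<pi> i))"


section \<open>Algorithms and their running time\<close>

text \<open>
  Algorithms are programs of a while language over rational scalar variables and rational arrays
  (unit-cost arithmetic). There is no rounding operation: an array index has to evaluate to a
  natural number. Division by zero and any other index make the execution stuck.
\<close>

datatype aexp =
    Num rat
  | Var string
  | Cell string aexp
  | Add aexp aexp
  | Sub aexp aexp
  | Mul aexp aexp
  | Div aexp aexp

datatype bexp =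
    Less aexp aexp
  | Equal aexp aexp
  | Neg bexp
  | Conj bexp bexp

datatype com =
    Skip
  | Assign string aexp
  | Store string aexp aexp
  | Seq com com
  | Cond bexp com com
  | While bexp com

record state =
  scalar :: "string \<Rightarrow> rat"
  arr :: "string \<Rightarrow> nat \<Rightarrow> rat"

definition index_of :: "rat \<Rightarrow> nat option" where
  "index_of x = (if x \<in> \<nat> then Some (THE k. x = of_nat k) else None)"

primrec aval :: "aexp \<Rightarrow> state \<Rightarrow> rat option" where
  "aval (Num c) s = Some c"
| "aval (Var x) s = Some (scalar s x)"
| "aval (Cell a e) s = do { x \<leftarrow> aval e s; k \<leftarrow> index_of x; Some (arr s a k) }"
| "aval (Add e f) s = do { x \<leftarrow> aval e s; y \<leftarrow> aval f s; Some (x + y) }"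
| "aval (Sub e f) s = do { x \<leftarrow> aval e s; y \<leftarrow> aval f s; Some (x - y) }"
| "aval (Mul e f) s = do { x \<leftarrow> aval e s; y \<leftarrow> aval f s; Some (x * y) }"
| "aval (Div e f) s = do { x \<leftarrow> aval e s; y \<leftarrow> aval f s; if y = 0 then None else Some (x / y) }"

primrec bval :: "bexp \<Rightarrow> state \<Rightarrow> bool option" where
  "bval (Less e f) s = do { x \<leftarrow> aval e s; y \<leftarrow> aval f s; Some (x < y) }"
| "bval (Equal e f) s = do { x \<leftarrow> aval e s; y \<leftarrow> aval f s; Some (x = y) }"
| "bval (Neg b) s = do { p \<leftarrow> bval b s; Some (\<not> p) }"
| "bval (Conj b c) s = do { p \<leftarrow> bval b s; q \<leftarrow> bval c s; Some (p \<and> q) }"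

text \<open>
  One unit of time is charged for every arithmetic operation, and also for every comparison,
  Boolean connective, array access and assignment. The running time is thus an upper bound for the
  number of arithmetic operations, also if comparisons are included in these. It agrees with the
  latter number up to a constant factor and an additive constant depending on the program, since
  every evaluation of a loop guard performs a comparison.
\<close>

primrec acost :: "aexp \<Rightarrow> nat" where
  "acost (Num c) = 0"
| "acost (Var x) = 0"
| "acost (Cell a e) = acost e + 1"
| "acost (Add e f) = acost e + acost f + 1"
| "acost (Sub e f) = acost e + acost f + 1"
| "acost (Mul e f) = acost e + acost f + 1"
| "acost (Div e f) = acost e + acost f + 1"

primrec bcost :: "bexp \<Rightarrow> nat" where
  "bcost (Less e f) = acost e + acost f + 1"
| "bcost (Equal e f) = acost e + acost f + 1"
| "bcost (Neg b) = bcost b + 1"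
| "bcost (Conj b c) = bcost b + bcost c + 1"

text \<open>\<open>exec c s t s'\<close>: started in \<open>s\<close>, the program \<open>c\<close> terminates in \<open>s'\<close> after time \<open>t\<close>.\<close>

inductive exec :: "com \<Rightarrow> state \<Rightarrow> nat \<Rightarrow> state \<Rightarrow> bool" where
  exec_Skip: "exec Skip s 0 s"
| exec_Assign: "aval e s = Some v \<Longrightarrow>
    exec (Assign x e) s (acost e + 1) (s\<lparr>scalar := (scalar s)(x := v)\<rparr>)"
| exec_Store: "aval e s = Some u \<Longrightarrow> index_of u = Some k \<Longrightarrow> aval f s = Some v \<Longrightarrow>
    exec (Store a e f) s (acost e + acost f + 1) (s\<lparr>arr := (arr s)(a := (arr s a)(k := v))\<rparr>)"
| exec_Seq: "exec c s t s' \<Longrightarrow> exec d s' t' s'' \<Longrightarrow> exec (Seq c d) s (t + t') s''"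
| exec_CondTrue: "bval b s = Some True \<Longrightarrow> exec c s t s' \<Longrightarrow> exec (Cond b c d) s (bcost b + t) s'"
| exec_CondFalse: "bval b s = Some False \<Longrightarrow> exec d s t s' \<Longrightarrow> exec (Cond b c d) s (bcost b + t) s'"
| exec_WhileFalse: "bval b s = Some False \<Longrightarrow> exec (While b c) s (bcost b) s"
| exec_WhileTrue: "bval b s = Some True \<Longrightarrow> exec c s t s' \<Longrightarrow> exec (While b c) s' t' s'' \<Longrightarrow>
    exec (While b c) s (bcost b + t + t') s''"

inductive_cases exec_SkipE: "exec Skip s t s'"
inductive_cases exec_AssignE: "exec (Assign x e) s t s'"
inductive_cases exec_StoreE: "exec (Store a e f) s t s'"
inductive_cases exec_SeqE: "exec (Seq c d) s t s'"
inductive_cases exec_CondE: "exec (Cond b c d) s t s'"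
inductive_cases exec_WhileE: "exec (While b c) s t s'"

lemma index_of_of_nat [simp]: "index_of (of_nat k) = Some k"
  by (simp add: index_of_def)

text \<open>Result and running time are determined by the program and the initial state.\<close>

lemma exec_deterministic: "exec c s t s' \<Longrightarrow> exec c s u s'' \<Longrightarrow> u = t \<and> s'' = s'"
proof (induction arbitrary: u s'' rule: exec.induct)
  case (exec_Skip s)
  then show ?case by (blast elim: exec_SkipE)
next
  case (exec_Assign e s v x)
  from exec_Assign.prems show ?case
    by (rule exec_AssignE) (simp add: exec_Assign.hyps)
next
  case (exec_Store e s x k f v a)
  from exec_Store.prems show ?case
    by (rule exec_StoreE) (use exec_Store.hyps in simp)
next
  case (exec_Seq c s t s' d t' s2)
  from exec_Seq.prems show ?case
    by (rule exec_SeqE) (use exec_Seq.IH in blast)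
next
  case (exec_CondTrue b s c t s' d)
  from exec_CondTrue.prems exec_CondTrue.hyps(1) obtain r where "u = bcost b + r" "exec c s r s''"
    by (elim exec_CondE) simp_all
  with exec_CondTrue.IH show ?case by blast
next
  case (exec_CondFalse b s d t s' c)
  from exec_CondFalse.prems exec_CondFalse.hyps(1) obtain r where "u = bcost b + r" "exec d s r s''"
    by (elim exec_CondE) simp_all
  with exec_CondFalse.IH show ?case by blast
next
  case (exec_WhileFalse b s c)
  from exec_WhileFalse.prems show ?case
    by (rule exec_WhileE) (use exec_WhileFalse.hyps in simp_all)
next
  case (exec_WhileTrue b s c t s' t' s2)
  note b = exec_WhileTrue.hyps(1)
  from exec_WhileTrue.prems show ?case
  proof (rule exec_WhileE)
    assume "bval b s = Some False"
    with b show ?thesis by simp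
  next
    fix t1 s1 t2
    assume u: "u = bcost b + t1 + t2" and c: "exec c s t1 s1" and w: "exec (While b c) s1 t2 s''"
    have 1: "t1 = t \<and> s1 = s'" by (rule exec_WhileTrue.IH(1)[OF c])
    have "t2 = t' \<and> s'' = s2" by (rule exec_WhileTrue.IH(2)) (use w 1 in simp)
    with u 1 show ?thesis by simp
  qed
qed

text \<open>The program gets \<open>n\<close>, \<open>E\<close>, \<open>i\<close> and the array \<open>w\<close> with entries at \<open>1, \<dots>, n\<close>; all
  other memory is zero. The result is left in the scalar variable \<open>phi\<close>.\<close>

definition input_state :: "nat \<Rightarrow> nat \<Rightarrow> (nat \<Rightarrow> nat) \<Rightarrow> nat \<Rightarrow> state" where
  "input_state n E w i =
     \<lparr>scalar = (\<lambda>_. 0)(''n'' := of_nat n, ''E'' := of_nat E, ''i'' := of_nat i),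
      arr = (\<lambda>_ _. 0)(''w'' := (\<lambda>j. if j \<in> {1..n} then of_nat (w j) else 0))\<rparr>"

definition result :: "state \<Rightarrow> rat" where
  "result s = scalar s ''phi''"

end

(* Grouping the permutations by the set T of players after i, with |T| = s and w(T) = k, gives
   phi_i as the sum of min(E - k, w_i) / ((n - s) * (n choose s)) over the coalitions T avoiding i
   with k < E. The numbers of such T with given (s, k) are coefficients of the product over j
   different from i of (1 + x^(n * w_j + 1)), at exponent n * k + s < n * E; multiplying out the
   n - 1 factors, truncated at degree n * E, takes O(n^2 E) operations. *)
theory Submission
  imports Defs "HOL-Combinatorics.Multiset_Permutations"
begin

section \<open>Permutations as lists, and the Shapley sum regrouped by coalitions\<close>

section \<open>The Shapley value as a sum over coalitions\<close>

text \<open>Passing to lists turns the predecessors of a player into a list prefix. Injectivity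
  rests on extensionality: outside \<open>{1..card N}\<close> two members of
  \<open>player_perms N\<close> agree anyway.\<close>

lemma bij_betw_player_perms_permutations_of_set:
  assumes "finite N"
  shows "bij_betw (\<lambda>\<pi>. map \<pi> [1..<Suc (card N)]) (player_perms N) (permutations_of_set N)"
proof (intro bij_betw_imageI inj_onI equalityI subsetI)
  fix \<pi> \<rho> :: "nat \<Rightarrow> 'a"
  assume "\<pi> \<in> player_perms N" "\<rho> \<in> player_perms N"
    and "map \<pi> [1..<Suc (card N)] = map \<rho> [1..<Suc (card N)]"
  then show "\<pi> = \<rho>"
    by (intro extensionalityI[of _ "{1..card N}"]) (auto simp: player_perms_def simp del: upt_Suc)
next
  fix xs
  assume "xs \<in> (\<lambda>\<pi>. map \<pi> [1..<Suc (card N)]) ` player_perms N"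
  then obtain \<pi> where xs: "xs = map \<pi> [1..<Suc (card N)]" and \<pi>: "bij_betw \<pi> {1..card N} N"
    by (auto simp: player_perms_def)
  have "set [1..<Suc (card N)] = {1..card N}" by auto
  with \<pi> show "xs \<in> permutations_of_set N"
    unfolding xs permutations_of_set_def
    by (simp add: bij_betw_def distinct_map del: upt_Suc set_upt)
next
  fix xs
  assume "xs \<in> permutations_of_set N"
  then have xs: "set xs = N" "distinct xs"
    by (auto simp: permutations_of_set_def)
  then have len: "length xs = card N"
    using distinct_card[of xs] by simp
  \<comment> \<open>Positions start at 1 but list indices at 0, hence \<open>k - 1\<close>;
    \<open>restrict\<close> makes the function extensional.\<close>
  define \<pi> where "\<pi> = restrict (\<lambda>k. xs ! (k - 1)) {1..card N}"
  have map: "map \<pi> [1..<Suc (card N)] = xs"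
  proof -
    have "map \<pi> [1..<Suc (card N)] = map (\<lambda>k. \<pi> (Suc k)) [0..<card N]"
      by (simp only: One_nat_def map_Suc_upt[symmetric] map_map o_def)
    also have "\<dots> = map ((!) xs) [0..<length xs]"
      by (intro map_cong) (simp_all add: \<pi>_def len)
    finally show ?thesis by (simp only: map_nth)
  qed
  have "set [1..<Suc (card N)] = {1..card N}" by auto
  then have "bij_betw \<pi> {1..card N} N"
    using xs unfolding map[symmetric] bij_betw_def
    by (simp add: distinct_map del: upt_Suc set_upt)
  then have "\<pi> \<in> player_perms N"
    by (simp add: player_perms_def \<pi>_def)
  with map show "xs \<in> (\<lambda>\<pi>. map \<pi> [1..<Suc (card N)]) ` player_perms N"
    by force
qed

text \<open>By injectivity \<open>i\<close> sits at exactly one position \<open>l\<close>, so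
  \<open>takeWhile\<close> stops precisely there and the existential in \<open>Prc\<close> has
  \<open>l\<close> as its only witness.\<close>

lemma Prc_conv_takeWhile:
  assumes "\<pi> \<in> player_perms N" "i \<in> N"
  shows "Prc N \<pi> i = set (takeWhile (\<lambda>x. x \<noteq> i) (map \<pi> [1..<Suc (card N)]))"
proof -
  from assms have inj: "inj_on \<pi> {1..card N}" and im: "\<pi> ` {1..card N} = N"
    by (auto simp: player_perms_def bij_betw_def)
  from assms(2) have "i \<in> \<pi> ` {1..card N}" by (simp only: im)
  then obtain l where l: "l \<in> {1..card N}" "\<pi> l = i" by (elim imageE) simp
  have uniq: "l' = l" if "l' \<in> {1..card N}" "\<pi> l' = i" for l'
    using inj_onD[OF inj, of l' l] that l by simp
  have split: "[1..<Suc (card N)] = [1..<l] @ l # [Suc l..<Suc (card N)]"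
  proof -
    obtain d where d: "Suc (card N) = l + Suc d"
      using l le_Suc_ex[of l "card N"] by auto
    have "[1..<l + Suc d] = [1..<l] @ [l..<l + Suc d]"
      by (rule upt_add_eq_append) (use l in simp)
    moreover have "[l..<l + Suc d] = l # [Suc l..<l + Suc d]"
      by (rule upt_conv_Cons) simp
    ultimately show ?thesis by (simp only: d)
  qed
  have "takeWhile (\<lambda>x. x \<noteq> i) (map \<pi> [1..<l] @ \<pi> l # map \<pi> [Suc l..<Suc (card N)]) = map \<pi> [1..<l]"
  proof (subst takeWhile_append2)
    fix x assume "x \<in> set (map \<pi> [1..<l])"
    then obtain k where "x = \<pi> k" "k \<in> {1..<l}" by (simp only: set_map set_upt) (elim imageE)
    then show "x \<noteq> i" using uniq[of k] l(1) by (cases "x = i") simp_all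
  qed (simp add: l(2))
  then have "set (takeWhile (\<lambda>x. x \<noteq> i) (map \<pi> [1..<Suc (card N)])) = \<pi> ` {1..<l}"
    unfolding split by (simp del: upt_Suc)
  moreover have "Prc N \<pi> i = \<pi> ` {1..<l}"
    using uniq l unfolding Prc_def by blast
  ultimately show ?thesis by simp
qed

text \<open>Such a list splits uniquely as \<open>ys @ i # zs\<close>, where \<open>ys\<close>
  arranges \<open>P\<close> and \<open>zs\<close> arranges the other players; the two arrangements
  are chosen independently.\<close>

lemma card_permutations_of_set_takeWhile:
  assumes "finite N" "i \<in> N" "P \<subseteq> N - {i}"
  shows "card {xs \<in> permutations_of_set N. set (takeWhile (\<lambda>x. x \<noteq> i) xs) = P}
           = fact (card P) * fact (card (N - {i} - P))"
proof -
  let ?A = "permutations_of_set P \<times> permutations_of_set (N - {i} - P)"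
  let ?f = "\<lambda>(ys, zs). ys @ i # zs"
  have tw: "takeWhile (\<lambda>x. x \<noteq> i) (ys @ i # zs) = ys" if "ys \<in> permutations_of_set P" for ys zs
    using that assms(3) by (subst takeWhile_append2) (auto simp: permutations_of_set_def)
  have "{xs \<in> permutations_of_set N. set (takeWhile (\<lambda>x. x \<noteq> i) xs) = P} = ?f ` ?A"
  proof (intro equalityI subsetI)
    fix xs
    assume "xs \<in> {xs \<in> permutations_of_set N. set (takeWhile (\<lambda>x. x \<noteq> i) xs) = P}"
    then have xs: "set xs = N" "distinct xs" and P: "set (takeWhile (\<lambda>x. x \<noteq> i) xs) = P"
      by (auto simp: permutations_of_set_def)
    from xs(1) assms(2) have "i \<in> set xs" by simp
    then obtain ys zs where yz: "xs = ys @ i # zs" "i \<notin> set ys"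
      by (meson split_list_first)
    then have "takeWhile (\<lambda>x. x \<noteq> i) xs = ys"
      by (subst yz, subst takeWhile_append2) auto
    with P xs yz have "(ys, zs) \<in> ?A"
      by (auto simp: permutations_of_set_def)
    with yz show "xs \<in> ?f ` ?A" by force
  next
    fix xs
    assume "xs \<in> ?f ` ?A"
    then show "xs \<in> {xs \<in> permutations_of_set N. set (takeWhile (\<lambda>x. x \<noteq> i) xs) = P}"
      using assms by (auto simp: tw) (auto simp: permutations_of_set_def)
  qed
  moreover have "inj_on ?f ?A"
    using tw by (auto intro!: inj_onI) (metis append_eq_append_conv list.inject)+
  moreover have "finite P" "finite (N - {i} - P)"
    using assms finite_subset by auto
  ultimately show ?thesis
    by (simp add: card_image card_cartesian_product)
qed

lemma card_player_perms_Prc: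
  assumes "finite N" "i \<in> N" "P \<subseteq> N - {i}"
  shows "card {\<pi> \<in> player_perms N. Prc N \<pi> i = P} = fact (card P) * fact (card (N - {i} - P))"
proof -
  let ?f = "\<lambda>\<pi>. map \<pi> [1..<Suc (card N)]"
  note bij = bij_betw_player_perms_permutations_of_set[OF assms(1)]
  have "bij_betw ?f {\<pi> \<in> player_perms N. Prc N \<pi> i = P}
          {xs \<in> permutations_of_set N. set (takeWhile (\<lambda>x. x \<noteq> i) xs) = P}"
  proof (rule bij_betw_subset[OF bij])
    have "?f ` {\<pi> \<in> player_perms N. Prc N \<pi> i = P}
        = {xs \<in> ?f ` player_perms N. set (takeWhile (\<lambda>x. x \<noteq> i) xs) = P}"
      using Prc_conv_takeWhile[OF _ assms(2)] by auto
    then show "?f ` {\<pi> \<in> player_perms N. Prc N \<pi> i = P}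
        = {xs \<in> permutations_of_set N. set (takeWhile (\<lambda>x. x \<noteq> i) xs) = P}"
      using bij by (simp add: bij_betw_def)
  qed auto
  from bij_betw_same_card[OF this] show ?thesis
    by (simp only: card_permutations_of_set_takeWhile[OF assms])
qed

text \<open>The marginal contribution depends on a permutation only through the predecessor set of
  \<open>i\<close>, so the sum is grouped by the fibres of \<open>Prc\<close>.\<close>

lemma shapley_sum_predecessors:
  assumes "finite N" "i \<in> N"
  shows "shapley N v i = (\<Sum>P\<in>Pow (N - {i}).
           fact (card P) * fact (card (N - {i} - P)) / fact (card N) * (v (insert i P) - v P))"
proof -
  let ?d = "\<lambda>P. v (insert i P) - v P"
  have fin: "finite (player_perms N)"
    using bij_betw_finite[OF bij_betw_player_perms_permutations_of_set[OF assms(1)]] by simp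
  have "Prc N \<pi> i \<in> Pow (N - {i})" if "\<pi> \<in> player_perms N" for \<pi>
  proof -
    have "set (map \<pi> [1..<Suc (card N)]) = N"
      using that bij_betw_player_perms_permutations_of_set[OF assms(1)]
      by (auto simp: bij_betw_def permutations_of_set_def simp del: set_map upt_Suc)
    then show ?thesis
      using Prc_conv_takeWhile[OF that assms(2)] by (auto dest: set_takeWhileD simp del: upt_Suc)
  qed
  then have "(\<Sum>\<pi>\<in>player_perms N. ?d (Prc N \<pi> i))
      = (\<Sum>P\<in>Pow (N - {i}). \<Sum>\<pi>\<in>{\<pi> \<in> player_perms N. Prc N \<pi> i = P}. ?d (Prc N \<pi> i))"
    by (intro sum.group[symmetric]) (use fin assms(1) in auto)
  also have "\<dots> = (\<Sum>P\<in>Pow (N - {i}). fact (card P) * fact (card (N - {i} - P)) * ?d P)"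
    by (intro sum.cong) (auto simp: card_player_perms_Prc[OF assms])
  finally show ?thesis
    by (simp add: shapley_def sum_divide_distrib)
qed

text \<open>Complementing within \<open>N - {i}\<close> indexes the sum by the players after
  \<open>i\<close>. This suits bankruptcy games, where the worth of \<open>N - T\<close> depends
  only on the weight of \<open>T\<close>. The factorials become a binomial coefficient, which is
  cheap to update as \<open>card T\<close> grows.\<close>

lemma shapley_sum_successors:
  assumes "finite N" "i \<in> N"
  shows "shapley N v i = (\<Sum>T\<in>Pow (N - {i}).
           (v (N - T) - v (N - {i} - T)) / (real (card N - card T) * real (card N choose card T)))"
proof -
  have "shapley N v i = (\<Sum>T\<in>Pow (N - {i}). fact (card (N - {i} - T)) *
           fact (card (N - {i} - (N - {i} - T))) / fact (card N) *
             (v (insert i (N - {i} - T)) - v (N - {i} - T)))"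
    unfolding shapley_sum_predecessors[OF assms]
    by (rule sum.reindex_bij_witness[of _ "\<lambda>T. N - {i} - T" "\<lambda>T. N - {i} - T"])
       (auto simp: double_diff)
  also have "\<dots> = (\<Sum>T\<in>Pow (N - {i}).
           (v (N - T) - v (N - {i} - T)) / (real (card N - card T) * real (card N choose card T)))"
  proof (rule sum.cong[OF refl])
    fix T assume T: "T \<in> Pow (N - {i})"
    have card: "card (N - {i} - T) = card N - Suc (card T)"
      using T assms by (subst card_Diff_subset) (auto intro: finite_subset)
    have less: "card T < card N"
      using T assms by (intro psubset_card_mono) auto
    have "N - {i} - (N - {i} - T) = T" "insert i (N - {i} - T) = N - T"
      using T assms by auto
    \<comment> \<open>Splitting off the top factor of the factorial, possible as
      \<open>card T < card N\<close>, exposes the binomial coefficient.\<close>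
    moreover have "fact (card N - card T) = real (card N - card T) * fact (card N - Suc (card T))"
      using less by (simp only: Suc_diff_Suc[symmetric] fact_Suc of_nat_mult)
    then have "fact (card N - Suc (card T)) * fact (card T) / fact (card N)
        = 1 / (real (card N - card T) * real (card N choose card T))"
      using less by (simp add: binomial_fact[of "card T" "card N"] divide_simps del: of_nat_diff)
    ultimately show "fact (card (N - {i} - T)) *
           fact (card (N - {i} - (N - {i} - T))) / fact (card N) *
             (v (insert i (N - {i} - T)) - v (N - {i} - T))
        = (v (N - T) - v (N - {i} - T)) / (real (card N - card T) * real (card N choose card T))"
      by (simp add: card)
  qed
  finally show ?thesis .
qed


section \<open>Subset-sum counts as polynomial coefficients, and the resulting double sum\<close>

section \<open>Counting coalitions\<close>

text \<open>For finite \<open>A\<close> this is the coefficient of \<open>x^m\<close> in the product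
  of the factors \<open>1 + x^(c j)\<close> over \<open>j\<close> in \<open>A\<close>.\<close>

definition subset_sum_count :: "'a set \<Rightarrow> ('a \<Rightarrow> nat) \<Rightarrow> nat \<Rightarrow> nat" where
  "subset_sum_count A c m = card {T \<in> Pow A. sum c T = m}"

lemma subset_sum_count_empty: "subset_sum_count {} c m = (if m = 0 then 1 else 0)"
proof -
  have "{T \<in> Pow {}. sum c T = m} = (if m = 0 then {{}} else {})" by auto
  then show ?thesis by (simp add: subset_sum_count_def)
qed

text \<open>Subsets are split by whether they contain \<open>x\<close>; this is multiplication by
  one more factor. The test \<open>c x \<le> m\<close> guards the truncated subtraction. The inner
  counting loop carries out exactly this recurrence.\<close>

lemma subset_sum_count_insert:
  assumes "finite A" "x \<notin> A"
  shows "subset_sum_count (insert x A) c m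
    = subset_sum_count A c m + (if c x \<le> m then subset_sum_count A c (m - c x) else 0)"
proof -
  let ?B = "{T \<in> Pow A. c x + sum c T = m}"
  have sum: "sum c (insert x T) = c x + sum c T" if "T \<subseteq> A" for T
    using that assms by (subst sum.insert) (auto intro: finite_subset)
  have "{T \<in> Pow (insert x A). sum c T = m} = {T \<in> Pow A. sum c T = m} \<union> insert x ` ?B"
    using sum by (auto simp: Pow_insert)
  moreover have "card ({T \<in> Pow A. sum c T = m} \<union> insert x ` ?B)
      = card {T \<in> Pow A. sum c T = m} + card (insert x ` ?B)"
    using assms by (intro card_Un_disjoint) auto
  moreover have "card (insert x ` ?B) = card ?B"
    using assms(2) by (intro card_image inj_onI) (subst (asm) insert_ident, auto)
  moreover have "?B = (if c x \<le> m then {T \<in> Pow A. sum c T = m - c x} else {})"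
    by auto
  ultimately show ?thesis
    by (simp add: subset_sum_count_def)
qed

text \<open>A coalition \<open>T\<close> missing a player has fewer than \<open>n\<close> members, so the single number
  \<open>n * w(T) + card T\<close> determines both its weight and its cardinality.\<close>

definition code_weight :: "nat \<Rightarrow> (nat \<Rightarrow> nat) \<Rightarrow> nat \<Rightarrow> nat" where
  "code_weight n w j = n * w j + 1"

lemma sum_code_weight: "sum (code_weight n w) T = sum w T * n + card T"
  by (simp add: code_weight_def sum_Suc sum_distrib_left mult.commute[of _ n])

text \<open>Removing \<open>i\<close> from \<open>N - T\<close> lowers the worth by
  \<open>min (E - w(T)) (w i)\<close>, which is 0 once \<open>w(T) \<ge> E\<close>. The remaining
  coalitions are grouped by cardinality and weight, and each group is counted through its
  code.\<close>

lemma shapley_bankruptcy_game: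
  assumes i: "i \<in> {1..n}"
  shows "shapley {1..n} (bankruptcy_game {1..n} (real E) (\<lambda>j. real (w j))) i
    = (\<Sum>s<n. \<Sum>k<E. real (subset_sum_count ({1..n} - {i}) (code_weight n w) (k * n + s))
         * real (min (E - k) (w i)) / (real (n - s) * real (n choose s)))"
proof -
  let ?N = "{1..n}" and ?A = "{1..n} - {i}"
  let ?v = "bankruptcy_game ?N (real E) (\<lambda>j. real (w j))"
  let ?g = "\<lambda>(s, k). real (min (E - k) (w i)) / (real (n - s) * real (n choose s))"
  let ?F = "{T \<in> Pow ?A. sum w T < E}"
  have diff: "?v (?N - T) - ?v (?N - {i} - T) = real (min (E - sum w T) (w i))" if "T \<subseteq> ?A" for T
  proof -
    have "?N - (?N - T) = T" "?N - (?N - {i} - T) = insert i T" using that i by auto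
    moreover have "i \<notin> T" "finite T" using that finite_subset by auto
    ultimately show ?thesis
      by (auto simp: bankruptcy_game_def of_nat_sum[symmetric] max_def min_def of_nat_diff
          simp del: of_nat_sum)
  qed
  have less: "card T < n" if "T \<subseteq> ?A" for T
  proof -
    have "T \<subset> ?N" using that i by blast
    then show ?thesis using psubset_card_mono[of ?N T] by simp
  qed
  have "shapley ?N ?v i = (\<Sum>T\<in>Pow ?A.
      (?v (?N - T) - ?v (?N - {i} - T)) / (real (n - card T) * real (n choose card T)))"
    using shapley_sum_successors[of ?N i ?v] i by simp
  also have "\<dots> = (\<Sum>T\<in>Pow ?A. ?g (card T, sum w T))"
    by (intro sum.cong refl) (simp only: diff Pow_iff prod.case)
  \<comment> \<open>Terms with \<open>sum w T \<ge> E\<close> vanish because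
    \<open>E - sum w T\<close> is a truncated subtraction.\<close>
  also have "\<dots> = (\<Sum>T\<in>?F. ?g (card T, sum w T))"
    by (rule sum.mono_neutral_right) auto
  also have "\<dots> = (\<Sum>p\<in>{..<n} \<times> {..<E}. \<Sum>T\<in>{T \<in> ?F. (card T, sum w T) = p}. ?g (card T, sum w T))"
    by (rule sum.group[symmetric]) (use less in auto)
  also have "\<dots> = (\<Sum>p\<in>{..<n} \<times> {..<E}. real (card {T \<in> ?F. (card T, sum w T) = p}) * ?g p)"
    by (intro sum.cong) (auto simp: case_prod_unfold)
  also have "\<dots> = (\<Sum>p\<in>{..<n} \<times> {..<E}.
      real (subset_sum_count ?A (code_weight n w) (snd p * n + fst p)) * ?g p)"
  proof (intro sum.cong refl)
    fix p assume p: "p \<in> {..<n} \<times> {..<E}"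
    \<comment> \<open>Uniqueness of quotient and remainder modulo \<open>n\<close>: both
      \<open>card T\<close> and \<open>fst p\<close> are below \<open>n\<close>.\<close>
    have "sum w T * n + card T = snd p * n + fst p \<longleftrightarrow> (card T, sum w T) = p" if "T \<subseteq> ?A" for T
    proof
      assume eq: "sum w T * n + card T = snd p * n + fst p"
      have "card T < n" "fst p < n" using less[OF that] p by auto
      then have "card T = fst p" "sum w T = snd p"
        using arg_cong[OF eq, of "\<lambda>x. x mod n"] arg_cong[OF eq, of "\<lambda>x. x div n"] by auto
      then show "(card T, sum w T) = p" by simp
    qed auto
    then have "{T \<in> ?F. (card T, sum w T) = p}
        = {T \<in> Pow ?A. sum (code_weight n w) T = snd p * n + fst p}"
      using p by (auto simp: sum_code_weight)
    then show "real (card {T \<in> ?F. (card T, sum w T) = p}) * ?g p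
        = real (subset_sum_count ?A (code_weight n w) (snd p * n + fst p)) * ?g p"
      by (simp add: subset_sum_count_def)
  qed
  also have "\<dots> = (\<Sum>s<n. \<Sum>k<E. real (subset_sum_count ?A (code_weight n w) (k * n + s)) * ?g (s, k))"
    by (simp add: sum.cartesian_product case_prod_unfold del: of_nat_diff)
  finally show ?thesis by simp
qed


section \<open>A calculus of time budgets for programs\<close>

section \<open>Total correctness with time bounds\<close>

text \<open>A total-correctness triple with time budget \<open>T\<close>. As execution is
  deterministic, asserting that one run exists describes the only run. The inequality lets branches
  of different cost share a budget.\<close>

definition reaches :: "com \<Rightarrow> state \<Rightarrow> nat \<Rightarrow> (state \<Rightarrow> bool) \<Rightarrow> bool" where
  "reaches c s T Q \<longleftrightarrow> (\<exists>t s'. exec c s t s' \<and> t \<le> T \<and> Q s')"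

lemma reaches_mono:
  "reaches c s T Q \<Longrightarrow> T \<le> T' \<Longrightarrow> (\<And>s'. Q s' \<Longrightarrow> Q' s') \<Longrightarrow> reaches c s T' Q'"
  unfolding reaches_def by (meson le_trans)

lemma reaches_Skip: "Q s \<Longrightarrow> reaches Skip s T Q"
  unfolding reaches_def using exec_Skip by blast

lemma reaches_Assign:
  "aval e s = Some v \<Longrightarrow> acost e + 1 \<le> T \<Longrightarrow> Q (s\<lparr>scalar := (scalar s)(x := v)\<rparr>) \<Longrightarrow>
    reaches (Assign x e) s T Q"
  unfolding reaches_def using exec_Assign by blast

lemma reaches_Store:
  "aval e s = Some (of_nat k) \<Longrightarrow> aval f s = Some v \<Longrightarrow> acost e + acost f + 1 \<le> T \<Longrightarrow>
    Q (s\<lparr>arr := (arr s)(a := (arr s a)(k := v))\<rparr>) \<Longrightarrow> reaches (Store a e f) s T Q"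
  unfolding reaches_def using exec_Store index_of_of_nat by blast

lemma reaches_Seq:
  "reaches c s T (\<lambda>s'. reaches d s' T' Q) \<Longrightarrow> reaches (Seq c d) s (T + T') Q"
  unfolding reaches_def using exec_Seq add_mono by blast

lemma reaches_Cond:
  assumes "bval b s = Some p" "p \<Longrightarrow> reaches c s T Q" "\<not> p \<Longrightarrow> reaches d s T Q"
  shows "reaches (Cond b c d) s (bcost b + T) Q"
  using assms unfolding reaches_def
  by (cases p) (fastforce intro: exec_CondTrue exec_CondFalse)+

text \<open>The invariant is indexed by the number of completed iterations, so it also settles
  termination: the guard holds before each of the \<open>K\<close> iterations and fails afterwards.
  The extra \<open>bcost b\<close> pays for the failing test.\<close>

lemma reaches_While:
  assumes "I 0 s"
    and step: "\<And>r s. r < K \<Longrightarrow> I r s \<Longrightarrow> bval b s = Some True \<and> reaches c s T (I (Suc r))"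
    and exit: "\<And>s. I K s \<Longrightarrow> bval b s = Some False"
  shows "reaches (While b c) s (K * (bcost b + T) + bcost b) (I K)"
proof -
  have "reaches (While b c) s ((K - r) * (bcost b + T) + bcost b) (I K)" if "r \<le> K" "I r s" for r s
    using that
  proof (induction "K - r" arbitrary: r s)
    case 0
    then show ?case
      unfolding reaches_def using exec_WhileFalse[OF exit] by fastforce
  next
    case (Suc d)
    then have r: "r < K" by simp
    from step[OF r Suc.prems(2)] obtain t1 s1 where
      b: "bval b s = Some True" and 1: "exec c s t1 s1" "t1 \<le> T" "I (Suc r) s1"
      by (auto simp: reaches_def)
    have "reaches (While b c) s1 ((K - Suc r) * (bcost b + T) + bcost b) (I K)"
      by (rule Suc.hyps(1)) (use Suc.hyps(2) r 1 in auto)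
    then obtain t2 s2 where
      2: "exec (While b c) s1 t2 s2" "t2 \<le> (K - Suc r) * (bcost b + T) + bcost b" "I K s2"
      by (auto simp: reaches_def)
    have "K - r = Suc (K - Suc r)" using r by simp
    then have "bcost b + t1 + t2 \<le> (K - r) * (bcost b + T) + bcost b"
      using 1 2 by simp
    then show ?case
      unfolding reaches_def using exec_WhileTrue[OF b 1(1) 2(1)] 2(3) by blast
  qed
  from this[of 0 s] assms(1) show ?thesis by simp
qed


section \<open>The program: polynomial multiplication followed by a double sum\<close>

section \<open>The algorithm\<close>

text \<open>Multiplies the polynomial stored in \<open>A\<close> in place by \<open>1 + x^c\<close>.
  Running \<open>m\<close> downwards keeps \<open>A[m - c]\<close> at its old value when read, so no
  player is used twice. The loop stops at \<open>m < c\<close>, before the index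
  \<open>m - c\<close> could become negative.\<close>

definition count_player :: com where
  "count_player =
     Seq (Assign ''c'' (Add (Mul (Var ''n'') (Cell ''w'' (Var ''j''))) (Num 1)))
    (Seq (Assign ''m'' (Sub (Mul (Var ''n'') (Var ''E'')) (Num 1)))
     (While (Neg (Less (Var ''m'') (Var ''c'')))
       (Seq (Store ''A'' (Var ''m'')
              (Add (Cell ''A'' (Var ''m'')) (Cell ''A'' (Sub (Var ''m'') (Var ''c'')))))
            (Assign ''m'' (Sub (Var ''m'') (Num 1))))))"

text \<open>Starts from the constant polynomial 1; the loop relies on \<open>j\<close> being 0 in
  the initial memory.\<close>

definition count_coalitions :: com where
  "count_coalitions =
     Seq (Store ''A'' (Num 0) (Num 1))
     (While (Less (Var ''j'') (Var ''n''))
       (Seq (Assign ''j'' (Add (Var ''j'') (Num 1)))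
            (Cond (Equal (Var ''j'') (Var ''i'')) Skip count_player)))"

definition accumulate :: com where
  "accumulate =
     Seq (Assign ''phi'' (Add (Var ''phi'')
        (Div (Mul (Cell ''A'' (Add (Mul (Var ''k'') (Var ''n'')) (Var ''s''))) (Var ''g''))
             (Mul (Sub (Var ''n'') (Var ''s'')) (Var ''b'')))))
     (Assign ''k'' (Add (Var ''k'') (Num 1)))"

definition add_term :: com where
  "add_term =
     Seq (Assign ''g'' (Sub (Var ''E'') (Var ''k'')))
    (Seq (Cond (Less (Cell ''w'' (Var ''i'')) (Var ''g''))
            (Assign ''g'' (Cell ''w'' (Var ''i''))) Skip)
         accumulate)"

text \<open>\<open>b\<close> carries \<open>n choose s\<close> from one \<open>s\<close> to the
  next, so no factorial is ever computed; \<open>s\<close> and \<open>phi\<close> start from their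
  initial value 0.\<close>

definition sum_terms :: com where
  "sum_terms =
     Seq (Assign ''b'' (Num 1))
     (While (Less (Var ''s'') (Var ''n''))
       (Seq (Assign ''k'' (Num 0))
       (Seq (While (Less (Var ''k'') (Var ''E'')) add_term)
       (Seq (Assign ''b'' (Div (Mul (Var ''b'') (Sub (Var ''n'') (Var ''s'')))
                               (Add (Var ''s'') (Num 1))))
            (Assign ''s'' (Add (Var ''s'') (Num 1)))))))"

definition shapley_program :: com where
  "shapley_program = Seq count_coalitions sum_terms"

section \<open>Correctness and running time of the counting phase\<close>

definition has_input :: "nat \<Rightarrow> nat \<Rightarrow> (nat \<Rightarrow> nat) \<Rightarrow> nat \<Rightarrow> state \<Rightarrow> bool" where
  "has_input n E w i s \<longleftrightarrow>
     scalar s ''n'' = of_nat n \<and> scalar s ''E'' = of_nat E \<and> scalar s ''i'' = of_nat i \<and>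
     (\<forall>j\<in>{1..n}. arr s ''w'' j = of_nat (w j))"

text \<open>Carried through the counting phase so that the summation may rely on these zero
  values.\<close>

definition unsummed :: "state \<Rightarrow> bool" where
  "unsummed s \<longleftrightarrow> scalar s ''s'' = 0 \<and> scalar s ''phi'' = 0"

lemma count_player_correct:
  assumes inp: "has_input n E w i s" "unsummed s"
    and j: "scalar s ''j'' = of_nat j" "j \<in> {1..n}"
  defines "c \<equiv> code_weight n w j"
  shows "reaches count_player s (n * E * 9 + 9) (\<lambda>s'. has_input n E w i s' \<and> unsummed s' \<and>
    scalar s' ''j'' = of_nat j \<and>
    (\<forall>x < n * E. arr s' ''A'' x = arr s ''A'' x + (if c \<le> x then arr s ''A'' (x - c) else 0)))"
    (is "reaches _ _ _ ?Q")
proof -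
  define N where "N = n * E"
  \<comment> \<open>After \<open>r\<close> iterations exactly the cells from \<open>N - r\<close> up
    to \<open>N - 1\<close> have been treated. \<open>m\<close> is rational, so its value
    \<open>N - 1 - r\<close> is a genuine, not a truncated, difference.\<close>
  define I where "I = (\<lambda>r s'. has_input n E w i s' \<and> unsummed s' \<and>
    scalar s' ''j'' = of_nat j \<and> scalar s' ''c'' = of_nat c \<and>
    scalar s' ''m'' = of_nat N - 1 - of_nat r \<and>
    (\<forall>x < N. arr s' ''A'' x = arr s ''A'' x +
       (if c \<le> x \<and> N \<le> x + r then arr s ''A'' (x - c) else 0)))"
  let ?b = "Neg (Less (Var ''m'') (Var ''c''))"
  let ?body = "Seq (Store ''A'' (Var ''m'')
      (Add (Cell ''A'' (Var ''m'')) (Cell ''A'' (Sub (Var ''m'') (Var ''c'')))))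
      (Assign ''m'' (Sub (Var ''m'') (Num 1)))"
  have c: "0 < c" by (simp add: c_def code_weight_def)
  have loop: "reaches (While ?b ?body) s' (N * 9 + 2) ?Q" if "I 0 s'" for s'
  proof -
    \<comment> \<open>The truncated \<open>N - c\<close> is the exact iteration count; it is 0 if
      the shift \<open>c\<close> exceeds the array range.\<close>
    have "reaches (While ?b ?body) s' ((N - c) * (bcost ?b + 7) + bcost ?b) (I (N - c))"
      using that
    proof (rule reaches_While)
      fix r s' assume r: "r < N - c" and I: "I r s'"
      define m where "m = N - Suc r"
      have N: "N = Suc (m + r)" and m: "c \<le> m" using r by (auto simp: m_def)
      have sm: "scalar s' ''m'' = of_nat m" and sc: "scalar s' ''c'' = of_nat c"
        using I by (auto simp: I_def N)
      have mc: "of_nat m - of_nat c = (of_nat (m - c) :: rat)"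
        using m by simp
      \<comment> \<open>Both cells lie below \<open>N - r\<close>, hence still hold their original
        values.\<close>
      have A: "arr s' ''A'' m = arr s ''A'' m" "arr s' ''A'' (m - c) = arr s ''A'' (m - c)"
        using I m c by (auto simp: I_def N)
      let ?v = "arr s ''A'' m + arr s ''A'' (m - c)"
      have "((arr s' ''A'')(m := ?v)) x = arr s ''A'' x +
          (if c \<le> x \<and> N \<le> x + Suc r then arr s ''A'' (x - c) else 0)" if "x < N" for x
        using that I m by (auto simp: I_def N)
      then have I': "I (Suc r) (s'\<lparr>arr := (arr s')(''A'' := (arr s' ''A'')(m := ?v)),
          scalar := (scalar s')(''m'' := of_nat m - 1)\<rparr>)"
        using I sm by (simp add: I_def has_input_def unsummed_def)
      have "reaches ?body s' (5 + 2) (I (Suc r))"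
      proof (intro reaches_Seq reaches_Store reaches_Assign)
        show "aval (Var ''m'') s' = Some (of_nat m)" by (simp add: sm)
        show "aval (Add (Cell ''A'' (Var ''m'')) (Cell ''A'' (Sub (Var ''m'') (Var ''c'')))) s'
            = Some ?v"
          by (simp add: sm sc mc A del: of_nat_diff)
      qed (use I' sm in simp_all)
      then show "bval ?b s' = Some True \<and> reaches ?body s' 7 (I (Suc r))"
        using m sm sc by simp
    next
      fix s' assume "I (N - c) s'"
      then have *: "scalar s' ''m'' = of_nat N - 1 - of_nat (N - c)"
        "scalar s' ''c'' = of_nat c" by (simp_all add: I_def)
      show "bval ?b s' = Some False"
      proof (cases "c \<le> N")
        case True
        then show ?thesis using * by simp
      next
        case False
        then have "(of_nat N :: rat) < of_nat c" by (simp only: of_nat_less_iff)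
        then show ?thesis using * False by simp
      qed
    qed
    moreover have "(N - c) * (bcost ?b + 7) + bcost ?b \<le> N * 9 + 2" by simp
    moreover have "?Q s''" if "I (N - c) s''" for s''
      using that by (auto simp: I_def N_def[symmetric])
    ultimately show ?thesis
      by (rule reaches_mono)
  qed
  have "reaches count_player s (4 + (3 + (N * 9 + 2))) ?Q"
    unfolding count_player_def
  proof (intro reaches_Seq reaches_Assign loop)
    show "aval (Add (Mul (Var ''n'') (Cell ''w'' (Var ''j''))) (Num 1)) s = Some (of_nat c)"
      using inp j by (simp add: has_input_def c_def code_weight_def)
    show "aval (Sub (Mul (Var ''n'') (Var ''E'')) (Num 1)) (s\<lparr>scalar := (scalar s)(''c'' := of_nat c)\<rparr>)
        = Some (of_nat N - 1)"
      using inp by (simp add: has_input_def N_def)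
  qed (use inp j in \<open>simp_all add: I_def has_input_def unsummed_def\<close>)
  then show ?thesis
    by (rule reaches_mono) (simp_all add: N_def)
qed

text \<open>After \<open>j\<close> rounds \<open>A\<close> holds the coefficients of the product
  over \<open>{1..j} - {i}\<close>; the round of player \<open>i\<close> changes nothing. Cutting
  off at degree \<open>n * E\<close> is harmless, since the recurrence never reads a higher degree
  than it writes.\<close>

lemma count_coalitions_correct:
  assumes inp: "has_input n E w i s" "unsummed s" and j: "scalar s ''j'' = 0"
    and A: "arr s ''A'' = (\<lambda>_. 0)"
  shows "reaches count_coalitions s (n * (n * E * 9 + 13) + 2) (\<lambda>s'. has_input n E w i s' \<and>
    unsummed s' \<and> (\<forall>x < n * E. arr s' ''A'' x =
      of_nat (subset_sum_count ({1..n} - {i}) (code_weight n w) x)))"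
    (is "reaches _ _ _ ?Q")
proof -
  let ?c = "code_weight n w"
  define I where "I = (\<lambda>j s'. has_input n E w i s' \<and> unsummed s' \<and> scalar s' ''j'' = of_nat j \<and>
    (\<forall>x < n * E. arr s' ''A'' x = of_nat (subset_sum_count ({1..j} - {i}) ?c x)))"
  let ?b = "Less (Var ''j'') (Var ''n'')"
  let ?body = "Seq (Assign ''j'' (Add (Var ''j'') (Num 1)))
    (Cond (Equal (Var ''j'') (Var ''i'')) Skip count_player)"
  have loop: "reaches (While ?b ?body) s' (n * (bcost ?b + (n * E * 9 + 12)) + bcost ?b) (I n)"
    if "I 0 s'" for s'
    using that
  proof (rule reaches_While)
    fix j s' assume j: "j < n" and I: "I j s'"
    let ?s = "s'\<lparr>scalar := (scalar s')(''j'' := of_nat (Suc j))\<rparr>"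
    have s: "has_input n E w i ?s" "unsummed ?s" "scalar ?s ''j'' = of_nat (Suc j)"
      using I by (auto simp: I_def has_input_def unsummed_def)
    have "reaches ?body s' (2 + (bcost (Equal (Var ''j'') (Var ''i'')) + (n * E * 9 + 9))) (I (Suc j))"
    proof (intro reaches_Seq reaches_Assign reaches_Cond reaches_Skip)
      show "aval (Add (Var ''j'') (Num 1)) s' = Some (of_nat (Suc j))"
        using I by (simp add: I_def)
      show "bval (Equal (Var ''j'') (Var ''i'')) ?s = Some (Suc j = i)"
        using s by (simp add: has_input_def del: of_nat_Suc)
      show "I (Suc j) ?s" if "Suc j = i"
      proof -
        have "{1..Suc j} - {i} = {1..j} - {i}" using that by auto
        then show ?thesis using I s by (simp add: I_def)
      qed
      show "reaches count_player ?s (n * E * 9 + 9) (I (Suc j))" if "Suc j \<noteq> i"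
      proof -
        have "{1..Suc j} - {i} = insert (Suc j) ({1..j} - {i})" using that by auto
        then have "subset_sum_count ({1..Suc j} - {i}) ?c x = subset_sum_count ({1..j} - {i}) ?c x +
            (if ?c (Suc j) \<le> x then subset_sum_count ({1..j} - {i}) ?c (x - ?c (Suc j)) else 0)" for x
          by (simp add: subset_sum_count_insert)
        moreover have "reaches count_player ?s (n * E * 9 + 9) (\<lambda>s''. has_input n E w i s'' \<and>
            unsummed s'' \<and> scalar s'' ''j'' = of_nat (Suc j) \<and> (\<forall>x < n * E. arr s'' ''A'' x =
              arr ?s ''A'' x + (if ?c (Suc j) \<le> x then arr ?s ''A'' (x - ?c (Suc j)) else 0)))"
          using s j by (intro count_player_correct) auto
        ultimately show ?thesis
          using I by (elim reaches_mono) (auto simp: I_def)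
      qed
    qed simp
    then have "reaches ?body s' (n * E * 9 + 12) (I (Suc j))"
      by (rule reaches_mono) simp_all
    moreover have "bval ?b s' = Some True"
      using I j by (simp add: I_def has_input_def)
    ultimately show "bval ?b s' = Some True \<and> reaches ?body s' (n * E * 9 + 12) (I (Suc j))"
      by blast
  qed (simp add: I_def has_input_def)
  have "reaches count_coalitions s (1 + (n * (bcost ?b + (n * E * 9 + 12)) + bcost ?b)) (I n)"
    unfolding count_coalitions_def
  proof (intro reaches_Seq reaches_Store loop)
    show "aval (Num 0) s = Some (of_nat 0)" by simp
    show "aval (Num 1) s = Some 1" by simp
    show "I 0 (s\<lparr>arr := (arr s)(''A'' := (arr s ''A'')(0 := 1))\<rparr>)"
      using inp j A by (auto simp: I_def has_input_def unsummed_def subset_sum_count_empty)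
  qed simp
  then show ?thesis
    by (rule reaches_mono) (auto simp: I_def)
qed

section \<open>Correctness and running time of the summation phase\<close>

definition phi_term :: "nat \<Rightarrow> nat \<Rightarrow> (nat \<Rightarrow> nat) \<Rightarrow> nat \<Rightarrow> nat \<Rightarrow> nat \<Rightarrow> rat" where
  "phi_term n E w i s k = of_nat (subset_sum_count ({1..n} - {i}) (code_weight n w) (k * n + s)) *
     of_nat (min (E - k) (w i)) / (of_nat (n - s) * of_nat (n choose s))"

text \<open>The interface between the two phases; it persists during the summation, which only reads
  \<open>A\<close>.\<close>

definition counted :: "nat \<Rightarrow> nat \<Rightarrow> (nat \<Rightarrow> nat) \<Rightarrow> nat \<Rightarrow> state \<Rightarrow> bool" where
  "counted n E w i s \<longleftrightarrow> has_input n E w i s \<and> (\<forall>x < n * E. arr s ''A'' x =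
     of_nat (subset_sum_count ({1..n} - {i}) (code_weight n w) x))"

lemma add_term_correct:
  assumes s: "counted n E w i s" "i \<in> {1..n}" "scalar s ''s'' = of_nat r" "r < n"
      "scalar s ''b'' = of_nat (n choose r)" "scalar s ''k'' = of_nat k" "k < E"
  shows "reaches add_term s 17 (\<lambda>s'. counted n E w i s' \<and> scalar s' ''s'' = of_nat r \<and>
    scalar s' ''b'' = of_nat (n choose r) \<and> scalar s' ''k'' = of_nat (Suc k) \<and>
    scalar s' ''phi'' = scalar s ''phi'' + phi_term n E w i r k)"
    (is "reaches _ _ _ ?Q")
proof -
  have inp: "scalar s ''n'' = of_nat n" "scalar s ''E'' = of_nat E" "scalar s ''i'' = of_nat i"
    "arr s ''w'' i = of_nat (w i)"
    using s by (auto simp: counted_def has_input_def)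
  \<comment> \<open>The cell read lies in the range where \<open>A\<close> is known to be
    correct.\<close>
  have "k * n + r < n * E"
  proof -
    have "k * n + r < Suc k * n" using s by simp
    also have "\<dots> \<le> E * n" using s by (intro mult_right_mono) auto
    finally show ?thesis by (simp add: mult.commute)
  qed
  then have A: "arr s ''A'' (k * n + r) =
      of_nat (subset_sum_count ({1..n} - {i}) (code_weight n w) (k * n + r))"
    using s by (simp add: counted_def)
  have idx: "of_nat k * of_nat n + of_nat r = (of_nat (k * n + r) :: rat)" by simp
  \<comment> \<open>A nonzero denominator, so that the division does not get stuck.\<close>
  have b: "(of_nat n - of_nat r) * of_nat (n choose r) \<noteq> (0 :: rat)"
    using s by simp
  let ?upd = "\<lambda>x. s\<lparr>scalar := (scalar s)(''g'' := of_nat x)\<rparr>"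
  \<comment> \<open>Stated for any state with the right \<open>g\<close>, so that it serves both
    branches of the conditional that computes the minimum.\<close>
  have tail: "reaches accumulate s' (9 + 2) ?Q"
    if s': "arr s' = arr s" "\<And>x. x \<noteq> ''g'' \<Longrightarrow> scalar s' x = scalar s x"
      "scalar s' ''g'' = of_nat (min (E - k) (w i))" for s'
    unfolding accumulate_def
  proof (intro reaches_Seq reaches_Assign)
    show "aval (Add (Var ''phi'')
            (Div (Mul (Cell ''A'' (Add (Mul (Var ''k'') (Var ''n'')) (Var ''s''))) (Var ''g''))
                 (Mul (Sub (Var ''n'') (Var ''s'')) (Var ''b'')))) s'
        = Some (scalar s ''phi'' + phi_term n E w i r k)"
      using s b by (simp add: s' inp idx A phi_term_def del: of_nat_add of_nat_mult)
  qed (use s s' in \<open>simp_all add: counted_def has_input_def\<close>)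
  have "reaches add_term s (2 + (bcost (Less (Cell ''w'' (Var ''i'')) (Var ''g'')) + 2 + (9 + 2))) ?Q"
    unfolding add_term_def
  proof (intro reaches_Seq reaches_Cond reaches_Assign reaches_Skip tail)
    show "aval (Sub (Var ''E'') (Var ''k'')) s = Some (of_nat (E - k))"
      using s inp by simp
    show "bval (Less (Cell ''w'' (Var ''i'')) (Var ''g'')) (?upd (E - k)) = Some (w i < E - k)"
      using inp by (simp del: of_nat_diff)
    show "aval (Cell ''w'' (Var ''i'')) (?upd (E - k)) = Some (of_nat (w i))"
      using inp by simp
  qed (auto simp: min_def)
  then show ?thesis by (rule reaches_mono) simp_all
qed

lemma sum_terms_correct:
  assumes s: "counted n E w i s" "unsummed s" "i \<in> {1..n}"
  shows "reaches sum_terms s (n * (E * 18 + 10) + 2) (\<lambda>s'.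
    scalar s' ''phi'' = (\<Sum>r<n. \<Sum>k<E. phi_term n E w i r k))"
proof -
  define I where "I = (\<lambda>r s'. counted n E w i s' \<and> scalar s' ''s'' = of_nat r \<and>
    scalar s' ''b'' = of_nat (n choose r) \<and>
    scalar s' ''phi'' = (\<Sum>r<r. \<Sum>k<E. phi_term n E w i r k))"
  define J where "J = (\<lambda>r k s'. counted n E w i s' \<and> scalar s' ''s'' = of_nat r \<and>
    scalar s' ''b'' = of_nat (n choose r) \<and> scalar s' ''k'' = of_nat k \<and>
    scalar s' ''phi'' = (\<Sum>r<r. \<Sum>k<E. phi_term n E w i r k) + (\<Sum>k<k. phi_term n E w i r k))"
  let ?c = "Less (Var ''k'') (Var ''E'')"
  have inner: "reaches (While ?c add_term) s' (E * (bcost ?c + 17) + bcost ?c) (J r E)"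
    if "J r 0 s'" "r < n" for r s'
    using that(1)
  proof (rule reaches_While)
    fix k s' assume k: "k < E" and J: "J r k s'"
    have "reaches add_term s' 17 (J r (Suc k))"
      by (rule reaches_mono[OF add_term_correct[of n E w i s' r k]])
         (use J k s that(2) in \<open>simp_all add: J_def\<close>)
    then show "bval ?c s' = Some True \<and> reaches add_term s' 17 (J r (Suc k))"
      using J k by (simp add: J_def counted_def has_input_def)
  qed (simp add: J_def counted_def has_input_def)
  let ?b = "Less (Var ''s'') (Var ''n'')"
  let ?step = "Seq (Assign ''b'' (Div (Mul (Var ''b'') (Sub (Var ''n'') (Var ''s'')))
                               (Add (Var ''s'') (Num 1))))
            (Assign ''s'' (Add (Var ''s'') (Num 1)))"
  have step: "reaches ?step s' (5 + 2) (I (Suc r))" if "J r E s'" "r < n" for r s'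
  proof (intro reaches_Seq reaches_Assign)
    \<comment> \<open>Both sides equal \<open>n * ((n - 1) choose r)\<close>; this justifies the
      update of \<open>b\<close>.\<close>
    have "Suc r * (n choose Suc r) = (n choose r) * (n - r)"
      using binomial_absorb_comp[of n r] binomial_absorption[of r n] by (simp add: mult.commute)
    from arg_cong[OF this, of "of_nat :: nat \<Rightarrow> rat"]
    have "of_nat (n choose r) * (of_nat n - of_nat r) / (of_nat r + 1) = (of_nat (n choose Suc r) :: rat)"
      using that(2) by (simp add: field_simps)
    moreover have "of_nat r + 1 \<noteq> (0 :: rat)"
      by (simp add: add_nonneg_eq_0_iff)
    ultimately show "aval (Div (Mul (Var ''b'') (Sub (Var ''n'') (Var ''s''))) (Add (Var ''s'') (Num 1))) s'
        = Some (of_nat (n choose Suc r))"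
      using that by (simp add: J_def counted_def has_input_def)
  qed (use that in \<open>simp_all add: I_def J_def counted_def has_input_def add.commute\<close>)
  let ?body = "Seq (Assign ''k'' (Num 0)) (Seq (While ?c add_term) ?step)"
  have outer: "reaches (While ?b ?body) s' (n * (bcost ?b + (1 + ((E * 18 + 1) + (5 + 2)))) + bcost ?b) (I n)"
    if "I 0 s'" for s'
    using that
  proof (rule reaches_While)
    fix r s' assume r: "r < n" and I: "I r s'"
    have "J r 0 (s'\<lparr>scalar := (scalar s')(''k'' := 0)\<rparr>)"
      using I by (simp add: I_def J_def counted_def has_input_def)
    from inner[OF this r]
    have "reaches (While ?c add_term) (s'\<lparr>scalar := (scalar s')(''k'' := 0)\<rparr>) (E * 18 + 1)
        (\<lambda>s'. reaches ?step s' (5 + 2) (I (Suc r)))"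
      by (rule reaches_mono) (simp, rule step[OF _ r])
    then have "reaches ?body s' (1 + ((E * 18 + 1) + (5 + 2))) (I (Suc r))"
      by (intro reaches_Seq reaches_Assign) simp_all
    then show "bval ?b s' = Some True \<and> reaches ?body s' (1 + ((E * 18 + 1) + (5 + 2))) (I (Suc r))"
      using I r by (simp add: I_def counted_def has_input_def)
  qed (simp add: I_def counted_def has_input_def)
  have "reaches sum_terms s (1 + (n * (bcost ?b + (1 + ((E * 18 + 1) + (5 + 2)))) + bcost ?b)) (I n)"
    unfolding sum_terms_def
    by (intro reaches_Seq reaches_Assign outer)
       (use s in \<open>simp_all add: I_def counted_def has_input_def unsummed_def\<close>)
  then show ?thesis
    by (rule reaches_mono) (auto simp: I_def)
qed

text \<open>Counting costs \<open>O(n * E)\<close> per player and the summation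
  \<open>O(n * E)\<close> altogether. The weights affect only array contents and shifts, so they do
  not enter the bound.\<close>

lemma shapley_program_correct:
  assumes "i \<in> {1..n}" "0 < E"
  shows "reaches shapley_program (input_state n E w i) (60 * (n\<^sup>2 * E)) (\<lambda>s.
    of_rat (result s) = shapley {1..n} (bankruptcy_game {1..n} (real E) (\<lambda>j. real (w j))) i)"
proof -
  have n: "1 \<le> n" using assms by auto
  have inp: "has_input n E w i (input_state n E w i)" "unsummed (input_state n E w i)"
    "scalar (input_state n E w i) ''j'' = 0" "arr (input_state n E w i) ''A'' = (\<lambda>_. 0)"
    by (auto simp: input_state_def has_input_def unsummed_def)
  have "reaches count_coalitions (input_state n E w i) (n * (n * E * 9 + 13) + 2) (\<lambda>s.
      reaches sum_terms s (n * (E * 18 + 10) + 2) (\<lambda>s'.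
        scalar s' ''phi'' = (\<Sum>r<n. \<Sum>k<E. phi_term n E w i r k)))"
    by (rule reaches_mono[OF count_coalitions_correct[OF inp] le_refl])
       (rule sum_terms_correct; use assms(1) in \<open>simp add: counted_def\<close>)
  then have "reaches shapley_program (input_state n E w i)
      ((n * (n * E * 9 + 13) + 2) + (n * (E * 18 + 10) + 2))
      (\<lambda>s'. scalar s' ''phi'' = (\<Sum>r<n. \<Sum>k<E. phi_term n E w i r k))"
    unfolding shapley_program_def by (rule reaches_Seq)
  then show ?thesis
  proof (rule reaches_mono)
    \<comment> \<open>Each lower-order term is absorbed into \<open>n\<^sup>2 * E\<close>, which
      gives the factor 9 + 18 + 23 + 4 = 54, below 60.\<close>
    have "n * E \<le> n\<^sup>2 * E" using n by (simp add: power2_eq_square)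
    moreover have "n \<le> n * E" using assms by simp
    moreover have "(n * (n * E * 9 + 13) + 2) + (n * (E * 18 + 10) + 2)
        = 9 * (n\<^sup>2 * E) + 18 * (n * E) + 23 * n + 4"
      by (simp add: algebra_simps power2_eq_square)
    ultimately show "(n * (n * E * 9 + 13) + 2) + (n * (E * 18 + 10) + 2) \<le> 60 * (n\<^sup>2 * E)"
      using n by linarith
    show "of_rat (result s) = shapley {1..n} (bankruptcy_game {1..n} (real E) (\<lambda>j. real (w j))) i"
      if "scalar s ''phi'' = (\<Sum>r<n. \<Sum>k<E. phi_term n E w i r k)" for s
      unfolding shapley_bankruptcy_game[OF assms(1)] result_def that phi_term_def
      \<comment> \<open>The embedding \<open>of_rat\<close> commutes with the field operations, so
        the rational double sum becomes the real one.\<close>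
      by (simp add: of_rat_sum of_rat_mult of_rat_divide del: of_nat_diff)
  qed
qed

theorem mainTheorem3:
  "\<exists>(c :: com) (C :: real). \<forall>(n :: nat) (E :: nat) (w :: nat \<Rightarrow> nat) (i :: nat).
     0 < E \<and> (\<forall>j\<in>{1..n}. 0 < w j) \<and> E < (\<Sum>j=1..n. w j) \<and> i \<in> {1..n} \<longrightarrow>
     (\<exists>t s. exec c (input_state n E w i) t s \<and>
        of_rat (result s)
          = shapley {1..n} (bankruptcy_game {1..n} (real E) (\<lambda>j. real (w j))) i \<and>
        real t \<le> C * (real n ^ 2 * real E))"
proof (rule exI[of _ shapley_program], rule exI[of _ 60], intro allI impI)
  fix n E i :: nat and w :: "nat \<Rightarrow> nat"
  assume "0 < E \<and> (\<forall>j\<in>{1..n}. 0 < w j) \<and> E < (\<Sum>j=1..n. w j) \<and> i \<in> {1..n}"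
  then obtain t s where "exec shapley_program (input_state n E w i) t s"
    and t: "t \<le> 60 * (n\<^sup>2 * E)"
    and "of_rat (result s) = shapley {1..n} (bankruptcy_game {1..n} (real E) (\<lambda>j. real (w j))) i"
    using shapley_program_correct[of i n E w] by (auto simp: reaches_def)
  moreover have "real t \<le> 60 * (real n ^ 2 * real E)"
    using of_nat_mono[OF t, where ?'a = real] by simp
  ultimately show "\<exists>t s. exec shapley_program (input_state n E w i) t s \<and>
      of_rat (result s)
        = shapley {1..n} (bankruptcy_game {1..n} (real E) (\<lambda>j. real (w j))) i \<and>
      real t \<le> 60 * (real n ^ 2 * real E)"
    by blast
qed

end
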